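(* Let $\mathbb{K}$ be an algebraically closed field of characteristic $0$. There exists an arrangement of lines in $\mathbb{P}^3=\mathbb{P}^3_{\mathbb{K}}$ (a finite set of lines), not all passing through the same point, such that for its defining ideal $I\subseteq \mathbb{K}[x,y,z,w]$ (the homogeneous ideal of all polynomials vanishing on the union of these lines) one has $I^{(3)}\nsubseteq I^2$.
   Context: Let $R=\mathbb{K}[x,y,z,w]$ be the homogeneous coordinate ring of $\mathbb{P}^3$. For a homogeneous ideal $I\subseteq R$ and an integer $m\geq 0$, the $m$-th symbolic power of $I$ is $I^{(m)}=\bigcap_{P\in \mathrm{Ass}(I)}\left(I^mR_P\cap R\right)$, where $\mathrm{Ass}(I)$ is the set of associated primes of $I$, $R_P$ is the localization of $R$ at $P$, and $I^mR_P\cap R$ is the preimage of $I^mR_P$ under $R\to R_P$. $I^2$ denotes the ordinary square of the ideal. *)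

theory Defs
  imports
    "HOL-Analysis.Cartesian_Space"
    "HOL-Library.Poly_Mapping"
    "HOL-Library.Numeral_Type"
    "HOL-Computational_Algebra.Polynomial_Factorial"
begin

section \<open>Ideals of a commutative ring\<close>

text \<open>An ideal is a submodule of the ring regarded as a module over itself.\<close>

lemma module_times: "module ((*) :: 'a::comm_ring_1 \<Rightarrow> 'a \<Rightarrow> 'a)"
  by unfold_locales (simp_all add: algebra_simps)

definition is_ideal :: "'a::comm_ring_1 set \<Rightarrow> bool" where
  "is_ideal I \<longleftrightarrow> module.subspace (*) I"

definition ideal_generated :: "'a::comm_ring_1 set \<Rightarrow> 'a set" where
  "ideal_generated S = module.span (*) S"

definition ideal_mult :: "'a::comm_ring_1 set \<Rightarrow> 'a set \<Rightarrow> 'a set" where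
  "ideal_mult I J = ideal_generated {a * b | a b. a \<in> I \<and> b \<in> J}"

fun ideal_power :: "'a::comm_ring_1 set \<Rightarrow> nat \<Rightarrow> 'a set" where
  "ideal_power I 0 = UNIV"
| "ideal_power I (Suc m) = ideal_mult I (ideal_power I m)"

definition is_prime_ideal :: "'a::comm_ring_1 set \<Rightarrow> bool" where
  "is_prime_ideal P \<longleftrightarrow>
     is_ideal P \<and> P \<noteq> UNIV \<and> (\<forall>a b. a * b \<in> P \<longrightarrow> a \<in> P \<or> b \<in> P)"

text \<open>As usual, the associated primes of \<open>I\<close> are those of the module \<open>R/I\<close>: the prime ideals
  that are the annihilator of the class of some \<open>f\<close> in \<open>R/I\<close>.\<close>

definition associated_primes :: "'a::comm_ring_1 set \<Rightarrow> 'a set set" where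
  "associated_primes I = {P. is_prime_ideal P \<and> (\<exists>f. P = {r. r * f \<in> I})}"


section \<open>Localization and symbolic powers\<close>

text \<open>For an integral domain \<open>R\<close>, the localization \<open>R\<^sub>P\<close> at a prime \<open>P\<close> is realized as a subring of
  the fraction field, and \<open>R \<rightarrow> R\<^sub>P\<close> is the restriction of \<^const>\<open>to_fract\<close>.\<close>

definition localization :: "'a::idom set \<Rightarrow> 'a fract set" where
  "localization P = {Fract a s | a s. s \<notin> P}"

definition is_ideal_of_localization :: "'a::idom set \<Rightarrow> 'a fract set \<Rightarrow> bool" where
  "is_ideal_of_localization P L \<longleftrightarrow>
     L \<subseteq> localization P \<and> 0 \<in> L \<and> (\<forall>x\<in>L. \<forall>y\<in>L. x + y \<in> L) \<and>
     (\<forall>c\<in>localization P. \<forall>x\<in>L. c * x \<in> L)"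

text \<open>The extension \<open>J R\<^sub>P\<close> of an ideal \<open>J\<close> of \<open>R\<close>.\<close>

definition extended_ideal :: "'a::idom set \<Rightarrow> 'a set \<Rightarrow> 'a fract set" where
  "extended_ideal J P = \<Inter> {L. is_ideal_of_localization P L \<and> to_fract ` J \<subseteq> L}"

definition symbolic_power :: "'a::idom set \<Rightarrow> nat \<Rightarrow> 'a set" where
  "symbolic_power I m =
     (\<Inter>P\<in>associated_primes I. to_fract -` extended_ideal (ideal_power I m) P)"


section \<open>Lines in projective 3-space and their ideals\<close>

text \<open>The ring \<open>\<bbbK>[x,y,z,w]\<close>: the four variables are indexed by the elements of the type \<open>4\<close>,
  and a monomial is given by its exponents.\<close>

type_synonym 'k poly4 = "(4 \<Rightarrow>\<^sub>0 nat) \<Rightarrow>\<^sub>0 'k"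

definition poly4_eval :: "'k::comm_ring_1 poly4 \<Rightarrow> 'k ^ 4 \<Rightarrow> 'k" where
  "poly4_eval f v = (\<Sum>m\<in>Poly_Mapping.keys f.
     Poly_Mapping.lookup f m * (\<Prod>i\<in>UNIV. (v $ i) ^ Poly_Mapping.lookup m i))"

text \<open>A point of projective 3-space is a one-dimensional subspace of \<open>\<bbbK>\<^sup>4\<close>; a line is the set of
  points contained in some two-dimensional subspace.\<close>

type_synonym 'k proj_point = "('k ^ 4) set"

definition proj_points :: "'k::field proj_point set" where
  "proj_points = {p. vec.subspace p \<and> vec.dim p = 1}"

definition proj_lines :: "'k::field proj_point set set" where
  "proj_lines = {{p \<in> proj_points. p \<subseteq> W} | W. vec.subspace W \<and> vec.dim W = 2}"

text \<open>A polynomial, homogeneous or not, vanishes at a point if it vanishes at all systems of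
  homogeneous coordinates of that point.  Over an infinite field, the set of polynomials vanishing
  on \<open>X\<close> in this sense is the ideal generated by the homogeneous polynomials vanishing on \<open>X\<close>.\<close>

definition vanishes_at :: "'k::field poly4 \<Rightarrow> 'k proj_point \<Rightarrow> bool" where
  "vanishes_at f p \<longleftrightarrow> (\<forall>v\<in>p. v \<noteq> 0 \<longrightarrow> poly4_eval f v = 0)"

definition vanishing_ideal :: "'k::field proj_point set \<Rightarrow> 'k poly4 set" where
  "vanishing_ideal X = {f. \<forall>p\<in>X. vanishes_at f p}"

end

theory Submission
  imports Defs
begin

text \<open>
  The Fermat configuration of 12 points in the projective plane, that is the nine points
  \<open>(e : d : 1)\<close> with \<open>e\<^sup>3 = d\<^sup>3 = 1\<close> and the three coordinate points, is the classical
  counterexample to the containment \<open>J\<^sup>(\<^sup>3\<^sup>) \<subseteq> J\<^sup>2\<close>: the product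
  \<open>f = (x\<^sup>3 - y\<^sup>3)(y\<^sup>3 - z\<^sup>3)(z\<^sup>3 - x\<^sup>3)\<close> of nine lines vanishes to order 3 at each of
  these points, but is not in \<open>J\<^sup>2\<close>.  The cone over the configuration with vertex
  \<open>(0 : 0 : 0 : 1)\<close> consists of 12 lines in 3-space with the same property.  These lines all meet in
  the vertex, so the line \<open>M = {x = w = 0}\<close>, which avoids the vertex, is added.  The element of
  \<open>I\<^sup>(\<^sup>3\<^sup>)\<close> outside \<open>I\<^sup>2\<close> is then \<open>F = w\<^sup>3 f\<close>, where the factor \<open>w\<^sup>3\<close> makes \<open>F\<close> vanish to order 3
  along \<open>M\<close>.

  \<open>F \<in> I\<^sup>(\<^sup>3\<^sup>)\<close>: an associated prime of the radical ideal \<open>I\<close> is contained in the ideal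
  \<open>I\<^sub>L\<close> of one of the lines (lemma \<open>associated_prime_subset\<close>), so it suffices to find for every line
  \<open>L\<close> some \<open>s \<notin> I\<^sub>L\<close> with \<open>s F \<in> I\<^sup>3\<close> (lemma \<open>witness_locally_in_cube\<close>).  If \<open>s\<close> vanishes on all the other
  lines and \<open>F = u a b c\<close> with \<open>a, b, c \<in> I\<^sub>L\<close>, then \<open>s\<^sup>3 F = u (s a)(s b)(s c) \<in> I\<^sup>3\<close>.
  For the coordinate points, \<open>F\<close> is a difference of two products of this form.

  \<open>F \<notin> I\<^sup>2\<close>: the linear functional that takes the difference of the coefficients of \<open>x\<^sup>6z\<^sup>3w\<^sup>3\<close> and
  \<open>y\<^sup>6z\<^sup>3w\<^sup>3\<close> has the value 2 on \<open>F\<close>, but vanishes on every product \<open>g h\<close> with \<open>g, h \<in> I\<close>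
  (lemma \<open>product_coeffs_swap\<close>).  Vanishing at the nine points
  \<open>(e : d : 1)\<close> says, by discrete Fourier inversion over the cube roots of unity, that in each bidegree
  with respect to \<open>(x, y, z)\<close> and \<open>w\<close>
  the coefficients of the monomials with prescribed exponents modulo 3 sum to 0
  (lemma \<open>residue_class_coeffs\<close>).  Together with vanishing at the coordinate points this
  leaves only the coefficients of \<open>y\<^sup>3z w\<^sup>l\<close> and \<open>y\<^sup>3z\<^sup>2w\<^sup>l\<close> to contribute to \<open>y\<^sup>6z\<^sup>3w\<^sup>3\<close>, and these are
  the negatives of the coefficients of \<open>x\<^sup>3z w\<^sup>l\<close> and \<open>x\<^sup>3z\<^sup>2w\<^sup>l\<close>; the signs cancel in a product.
\<close>

section \<open>Evaluation of polynomials\<close>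

abbreviation lookup where "lookup \<equiv> Poly_Mapping.lookup"
abbreviation keys where "keys \<equiv> Poly_Mapping.keys"
abbreviation single where "single \<equiv> Poly_Mapping.single"

definition monomial_value :: "'k::comm_ring_1 ^ 4 \<Rightarrow> (4 \<Rightarrow>\<^sub>0 nat) \<Rightarrow> 'k" where
  "monomial_value v m = (\<Prod>i\<in>UNIV. (v $ i) ^ lookup m i)"

lemma monomial_value_0 [simp]: "monomial_value v 0 = 1"
  by (simp add: monomial_value_def)

lemma monomial_value_add: "monomial_value v (m + n) = monomial_value v m * monomial_value v n"
  by (simp add: monomial_value_def lookup_add power_add prod.distrib)

lemma poly4_eval_alt:
  assumes "finite S" "keys f \<subseteq> S"
  shows "poly4_eval f v = (\<Sum>m\<in>S. lookup f m * monomial_value v m)"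
  unfolding poly4_eval_def monomial_value_def
  by (rule sum.mono_neutral_left) (use assms in \<open>auto simp: in_keys_iff\<close>)

lemma poly4_eval_single [simp]: "poly4_eval (single m c) v = c * monomial_value v m"
  by (subst poly4_eval_alt[where S = "{m}"]) auto

lemma poly4_eval_add [simp]: "poly4_eval (f + g) v = poly4_eval f v + poly4_eval g v"
proof -
  have "keys (f + g) \<subseteq> keys f \<union> keys g" by (rule keys_add)
  then show ?thesis
    by (subst (1 2 3) poly4_eval_alt[where S = "keys f \<union> keys g"])
       (auto simp: lookup_add distrib_right sum.distrib)
qed

lemma poly4_eval_0 [simp]: "poly4_eval 0 v = 0"
  by (simp add: poly4_eval_def)

lemma poly4_eval_1 [simp]: "poly4_eval 1 v = 1"
  using poly4_eval_single[of 0 1 v] by simp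

lemma poly4_eval_sum: "poly4_eval (sum f A) v = (\<Sum>a\<in>A. poly4_eval (f a) v)"
  by (induction A rule: infinite_finite_induct) auto

lemma poly4_eval_uminus [simp]: "poly4_eval (- f) v = - poly4_eval f v"
  using poly4_eval_add[of f "- f" v] by (simp add: eq_neg_iff_add_eq_0 add.commute)

lemma poly4_eval_diff [simp]: "poly4_eval (f - g) v = poly4_eval f v - poly4_eval g v"
  using poly4_eval_add[of f "- g" v] by simp

lemma sum_singles: "f = (\<Sum>m\<in>keys f. single m (lookup f m))"
proof (rule poly_mapping_eqI)
  fix k
  have "lookup (\<Sum>m\<in>keys f. single m (lookup f m)) k =
      (\<Sum>m\<in>keys f. if m = k then lookup f m else 0)"
    by (simp add: lookup_sum lookup_single when_def)
  also have "\<dots> = lookup f k" by (auto simp: sum.delta in_keys_iff)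
  finally show "lookup f k = lookup (\<Sum>m\<in>keys f. single m (lookup f m)) k" ..
qed

lemma mult_eq_sum_singles:
  "f * g = (\<Sum>m\<in>keys f. \<Sum>n\<in>keys g. single (m + n) (lookup f m * lookup g n))"
proof -
  have "f * g = (\<Sum>m\<in>keys f. single m (lookup f m)) * (\<Sum>n\<in>keys g. single n (lookup g n))"
    using sum_singles[of f] sum_singles[of g] by simp
  then show ?thesis by (simp add: sum_product mult_single)
qed

lemma poly4_eval_mult [simp]: "poly4_eval (f * g) v = poly4_eval f v * poly4_eval g v"
proof -
  have "poly4_eval (f * g) v =
      (\<Sum>m\<in>keys f. \<Sum>n\<in>keys g. lookup f m * lookup g n * monomial_value v (m + n))"
    by (subst mult_eq_sum_singles) (simp add: poly4_eval_sum)
  also have "\<dots> = (\<Sum>m\<in>keys f. lookup f m * monomial_value v m) *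
      (\<Sum>n\<in>keys g. lookup g n * monomial_value v n)"
    by (simp add: sum_product monomial_value_add mult_ac)
  also have "\<dots> = poly4_eval f v * poly4_eval g v"
    using poly4_eval_alt[of "keys f" f v] poly4_eval_alt[of "keys g" g v] by simp
  finally show ?thesis .
qed

lemma poly4_eval_power [simp]: "poly4_eval (f ^ n) v = poly4_eval f v ^ n"
  by (induction n) auto

definition mon :: "nat \<Rightarrow> nat \<Rightarrow> nat \<Rightarrow> nat \<Rightarrow> (4 \<Rightarrow>\<^sub>0 nat)" where
  "mon a b c d = single 1 a + single 2 b + single 3 c + single 4 d"

lemma lookup_mon [simp]:
  "lookup (mon a b c d) 1 = a" "lookup (mon a b c d) 2 = b"
  "lookup (mon a b c d) 3 = c" "lookup (mon a b c d) 4 = d"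
  by (simp_all add: mon_def lookup_add lookup_single when_def)

lemma mon_lookup: "mon (lookup m 1) (lookup m 2) (lookup m 3) (lookup m 4) = m"
proof (rule poly_mapping_eqI)
  fix i :: 4
  show "lookup (mon (lookup m 1) (lookup m 2) (lookup m 3) (lookup m 4)) i = lookup m i"
    using exhaust_4[of i] by auto
qed

lemma mon_eq_iff [simp]: "mon a b c d = mon a' b' c' d' \<longleftrightarrow> a = a' \<and> b = b' \<and> c = c' \<and> d = d'"
  by (metis lookup_mon)

lemma mon_add [simp]: "mon a b c d + mon a' b' c' d' = mon (a + a') (b + b') (c + c') (d + d')"
proof (rule poly_mapping_eqI)
  fix i :: 4
  show "lookup (mon a b c d + mon a' b' c' d') i =
      lookup (mon (a + a') (b + b') (c + c') (d + d')) i"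
    using exhaust_4[of i] by (elim disjE) (simp_all only: lookup_add lookup_mon)
qed

lemma mon_cases: obtains a b c d where "m = mon a b c d"
  by (metis mon_lookup)

lemma monomial_value_mon:
  "monomial_value v (mon a b c d) = (v $ 1) ^ a * (v $ 2) ^ b * (v $ 3) ^ c * (v $ 4) ^ d"
  unfolding monomial_value_def UNIV_4 by (simp add: mult.assoc)

definition vec4 :: "'k \<Rightarrow> 'k \<Rightarrow> 'k \<Rightarrow> 'k \<Rightarrow> 'k ^ 4" where
  "vec4 a b c d = (\<chi> i. if i = 1 then a else if i = 2 then b else if i = 3 then c else d)"

lemma vec4_nth [simp]:
  "vec4 a b c d $ 1 = a" "vec4 a b c d $ 2 = b" "vec4 a b c d $ 3 = c" "vec4 a b c d $ 4 = d"
  by (simp_all add: vec4_def)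

lemma vec4_eq_iff: "(v :: 'k ^ 4) = w \<longleftrightarrow> v$1 = w$1 \<and> v$2 = w$2 \<and> v$3 = w$3 \<and> v$4 = w$4"
  by (simp add: vec_eq_iff forall_4)

lemma poly4_eval_on_line:
  fixes f :: "'k::comm_ring_1 poly4"
  shows "\<exists>p. \<forall>t. poly4_eval f (u + t *s v) = poly p t"
proof (intro exI allI)
  fix t
  show "poly4_eval f (u + t *s v) =
      poly (\<Sum>m\<in>keys f. smult (lookup f m) (\<Prod>i\<in>UNIV. [:u $ i, v $ i:] ^ lookup m i)) t"
    by (simp add: poly4_eval_def poly_sum poly_prod)
qed

lemma poly_0_if_zero_off_0:
  fixes p :: "'k::field_char_0 poly"
  assumes "\<And>t. t \<noteq> 0 \<Longrightarrow> poly p t = 0"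
  shows "p = 0"
proof (rule ccontr)
  assume "p \<noteq> 0"
  then have "finite {t. poly p t = 0}" by (rule poly_roots_finite)
  moreover have "- {0} \<subseteq> {t. poly p t = 0}" using assms by auto
  ultimately have "finite (- {0 :: 'k})" by (rule finite_subset[rotated])
  then have "finite (UNIV :: 'k set)" by simp
  then show False using infinite_UNIV_char_0 by blast
qed

text \<open>Needed because vanishing on a projective line only speaks of nonzero vectors, whereas it is
  convenient to work with vanishing on the whole subspace.\<close>

lemma poly4_eval_at_0:
  fixes f :: "'k::field_char_0 poly4"
  assumes "\<And>t. t \<noteq> 0 \<Longrightarrow> poly4_eval f (t *s v) = 0"
  shows "poly4_eval f 0 = 0"
proof -
  obtain p where p: "\<And>t. poly4_eval f (0 + t *s v) = poly p t"
    using poly4_eval_on_line by blast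
  have "p = 0" by (rule poly_0_if_zero_off_0) (use assms p in simp)
  with p[of 0] show ?thesis by simp
qed

text \<open>Primality of the ideal of a linear subspace, by restriction to the line joining \<open>q\<close> and \<open>v\<close>: there
  \<open>f\<close> and \<open>g\<close> become polynomials in one variable, whose product is 0 because the field is infinite.\<close>

lemma vanishing_on_subspace_prime:
  fixes f g :: "'k::field_char_0 poly4"
  assumes W: "vec.subspace W"
    and fg: "\<And>v. v \<in> W \<Longrightarrow> poly4_eval (f * g) v = 0"
    and q: "q \<in> W" "poly4_eval g q \<noteq> 0" and v: "v \<in> W"
  shows "poly4_eval f v = 0"
proof -
  obtain a where a: "\<And>t. poly4_eval f (q + t *s (v - q)) = poly a t"
    using poly4_eval_on_line by blast
  obtain b where b: "\<And>t. poly4_eval g (q + t *s (v - q)) = poly b t"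
    using poly4_eval_on_line by blast
  have "a * b = 0"
  proof (rule poly_0_if_zero_off_0)
    fix t
    have "q + t *s (v - q) \<in> W"
      using W q v by (intro vec.subspace_add vec.subspace_scale vec.subspace_diff)
    then show "poly (a * b) t = 0" using fg a b by force
  qed
  moreover have "b \<noteq> 0" using b[of 0] q by auto
  ultimately have "a = 0" by simp
  then show ?thesis using a[of 1] by simp
qed

section \<open>Ideal powers and symbolic powers\<close>

lemma is_ideal_generated: "is_ideal (ideal_generated S)"
  unfolding is_ideal_def ideal_generated_def by (rule module.subspace_span[OF module_times])

lemma ideal_multI: "a \<in> I \<Longrightarrow> b \<in> J \<Longrightarrow> a * b \<in> ideal_mult I J"
  unfolding ideal_mult_def ideal_generated_def by (intro module.span_base[OF module_times]) auto

lemma cube_in_ideal_power: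
  assumes "a \<in> I" "b \<in> I" "c \<in> I"
  shows "u * (a * b * c) \<in> ideal_power I 3"
proof -
  have "a * (b * (c * u)) \<in> ideal_power I 3"
    using assms by (simp add: numeral_3_eq_3 ideal_multI)
  then show ?thesis by (simp add: mult_ac)
qed

lemma diff_in_ideal_power:
  assumes "x \<in> ideal_power I m" "y \<in> ideal_power I m"
  shows "x - y \<in> ideal_power I m"
proof (cases m)
  case (Suc n)
  have "is_ideal (ideal_power I m)"
    by (simp add: Suc ideal_mult_def is_ideal_generated)
  then show ?thesis
    using assms unfolding is_ideal_def by (intro module.subspace_diff[OF module_times])
qed simp

text \<open>The property \<open>Q\<close> is meant to be the vanishing of an additive functional, which need not be
  compatible with multiplication by scalars of the ring.  This suffices because \<open>r (a b) = (r a) b\<close>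
  is again a product of two elements of \<open>I\<close>.\<close>

lemma ideal_square_induct:
  assumes I: "is_ideal I" and h: "h \<in> ideal_power I 2"
    and prod: "\<And>a b. a \<in> I \<Longrightarrow> b \<in> I \<Longrightarrow> Q (a * b)"
    and zero: "Q 0" and add: "\<And>x y. Q x \<Longrightarrow> Q y \<Longrightarrow> Q (x + y)"
  shows "Q h"
proof -
  have I_mult: "r * a \<in> I" if "a \<in> I" for r a
    using that I module.subspace_scale[OF module_times] unfolding is_ideal_def by blast
  have "ideal_mult I UNIV \<subseteq> I"
    unfolding ideal_mult_def ideal_generated_def
    by (rule module.span_minimal[OF module_times]) (use I I_mult in \<open>auto simp: is_ideal_def mult.commute\<close>)
  then have "{a * b |a b. a \<in> I \<and> b \<in> ideal_mult I UNIV} \<subseteq> {a * b |a b. a \<in> I \<and> b \<in> I}"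
    by blast
  then have "ideal_mult I (ideal_mult I UNIV) \<subseteq> module.span (*) {a * b |a b. a \<in> I \<and> b \<in> I}"
    unfolding ideal_mult_def[of I "ideal_mult I UNIV"] ideal_generated_def
    by (rule module.span_mono[OF module_times])
  then have "h \<in> module.span (*) {a * b |a b. a \<in> I \<and> b \<in> I}"
    using h by (auto simp: numeral_2_eq_2)
  then have "\<forall>r. Q (r * h)"
  proof (induction rule: module.span_induct[OF module_times, consumes 1, case_names base step])
    case base
    show ?case
      by (rule module.subspaceI[OF module_times]) (auto simp: zero add distrib_left mult.assoc[symmetric])
  next
    case (step x)
    then show ?case using prod I_mult by (auto simp: mult.assoc[symmetric])
  qed
  then show ?thesis by (metis mult_1)
qed

text \<open>If \<open>s F\<close> is in the power and \<open>s \<notin> P\<close>, then \<open>F = s\<^sup>-\<^sup>1 (s F)\<close> is in its extension to the localization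
  at \<open>P\<close>.\<close>

lemma symbolic_powerI:
  fixes I :: "'a::idom set"
  assumes "\<And>P. P \<in> associated_primes I \<Longrightarrow> \<exists>s. s \<notin> P \<and> s * F \<in> ideal_power I m"
  shows "F \<in> symbolic_power I m"
  unfolding symbolic_power_def extended_ideal_def
proof (intro INT_I vimageI2 InterI, elim CollectE conjE)
  fix P L
  assume P: "P \<in> associated_primes I" and L: "is_ideal_of_localization P L"
    and sub: "to_fract ` ideal_power I m \<subseteq> L"
  obtain s where s: "s \<notin> P" "s * F \<in> ideal_power I m" using assms[OF P] by blast
  have "0 \<in> P"
    using P module.subspace_0[OF module_times]
    unfolding associated_primes_def is_prime_ideal_def is_ideal_def by blast
  with s have "s \<noteq> 0" by blast
  have "Fract 1 s \<in> localization P" using s by (auto simp: localization_def)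
  moreover have "to_fract (s * F) \<in> L" using s sub by blast
  ultimately have "Fract 1 s * to_fract (s * F) \<in> L"
    using L unfolding is_ideal_of_localization_def by blast
  also have "Fract 1 s * to_fract (s * F) = to_fract F"
    using \<open>s \<noteq> 0\<close> by (simp add: to_fract_def eq_fract mult.commute)
  finally show "to_fract F \<in> L" .
qed

section \<open>Ideals of lines\<close>

definition subspace_ideal :: "('k::field ^ 4) set \<Rightarrow> 'k poly4 set" where
  "subspace_ideal W = {f. \<forall>v\<in>W. poly4_eval f v = 0}"

definition proj_line :: "('k::field ^ 4) set \<Rightarrow> 'k proj_point set" where
  "proj_line W = {p \<in> proj_points. p \<subseteq> W}"

lemma span_in_proj_points:
  assumes "v \<noteq> 0" shows "vec.span {v} \<in> proj_points"
proof -
  have "vec.independent {v}" using assms by simp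
  then have "vec.dim {v} = 1" by (simp add: vec.dim_eq_card_independent)
  then show ?thesis by (simp add: proj_points_def vec.subspace_span)
qed

lemma vanishing_ideal_proj_line:
  fixes W :: "('k::field_char_0 ^ 4) set"
  assumes W: "vec.subspace W" "vec.dim W = 2"
  shows "vanishing_ideal (proj_line W) = subspace_ideal W"
proof (intro equalityI subsetI)
  fix f :: "'k poly4" assume f: "f \<in> vanishing_ideal (proj_line W)"
  have *: "poly4_eval f v = 0" if v: "v \<in> W" "v \<noteq> 0" for v
  proof -
    have "vec.span {v} \<subseteq> W" using W v by (intro vec.span_minimal) auto
    then have "vanishes_at f (vec.span {v})"
      using f span_in_proj_points[OF v(2)]
      by (auto simp: vanishing_ideal_def proj_line_def)
    then show ?thesis using v vec.span_base[of v "{v}"] by (auto simp: vanishes_at_def)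
  qed
  have "\<not> W \<subseteq> {0}"
  proof
    assume "W \<subseteq> {0}"
    then have "W \<subseteq> vec.span {}" by simp
    then have "vec.dim W \<le> card ({} :: ('k ^ 4) set)" by (intro vec.dim_le_card) auto
    with W show False by simp
  qed
  then obtain u where u: "u \<in> W" "u \<noteq> 0" by blast
  have "poly4_eval f (t *s u) = 0" if "t \<noteq> 0" for t
    using that u W by (intro *) (auto intro: vec.subspace_scale)
  then have "poly4_eval f 0 = 0" by (rule poly4_eval_at_0)
  then show "f \<in> subspace_ideal W" using * by (auto simp: subspace_ideal_def)
qed (auto simp: subspace_ideal_def vanishing_ideal_def vanishes_at_def proj_line_def)

lemma vanishing_ideal_Union: "vanishing_ideal (\<Union>\<L>) = (\<Inter>L\<in>\<L>. vanishing_ideal L)"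
  by (auto simp: vanishing_ideal_def)

lemma is_ideal_Inter_subspace_ideal: "is_ideal (\<Inter>W\<in>\<W>. subspace_ideal W)"
  unfolding is_ideal_def
  by (rule module.subspaceI[OF module_times]) (auto simp: subspace_ideal_def)

text \<open>If \<open>P\<close> is the annihilator of the class of \<open>g\<close>, then \<open>g\<close> does not vanish on some subspace \<open>W\<close> of the
  family, and everything that multiplies \<open>g\<close> into the ideal vanishes on \<open>W\<close>.\<close>

lemma associated_prime_subset:
  fixes \<W> :: "('k::field_char_0 ^ 4) set set"
  assumes \<W>: "\<And>W. W \<in> \<W> \<Longrightarrow> vec.subspace W"
    and P: "P \<in> associated_primes (\<Inter>W\<in>\<W>. subspace_ideal W)"
  shows "\<exists>W\<in>\<W>. P \<subseteq> subspace_ideal W"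
proof -
  let ?I = "\<Inter>W\<in>\<W>. subspace_ideal W"
  obtain g where g: "P = {r. r * g \<in> ?I}" and "P \<noteq> UNIV"
    using P by (auto simp: associated_primes_def is_prime_ideal_def)
  then have "g \<notin> ?I" by (auto simp: subspace_ideal_def)
  then obtain W q where Wq: "W \<in> \<W>" "q \<in> W" "poly4_eval g q \<noteq> 0"
    by (auto simp: subspace_ideal_def)
  have "r \<in> subspace_ideal W" if "r \<in> P" for r
  proof -
    have "poly4_eval (r * g) v = 0" if "v \<in> W" for v
      using \<open>r \<in> P\<close> that Wq unfolding g subspace_ideal_def by blast
    then show ?thesis
      unfolding subspace_ideal_def
      using vanishing_on_subspace_prime[of W r g q] \<W> Wq by blast
  qed
  with Wq show ?thesis by blast
qed

lemma span2: "vec.span {u, v} = {s *s u + t *s v | s t. True}"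
proof (intro equalityI subsetI)
  fix x assume "x \<in> vec.span {u, v}"
  then obtain s t where "x - s *s u = t *s v"
    by (auto simp: vec.span_insert vec.span_singleton)
  then have "x = s *s u + t *s v" by (simp add: algebra_simps)
  then show "x \<in> {s *s u + t *s v | s t. True}" by blast
next
  fix x assume "x \<in> {s *s u + t *s v | s t. True}"
  then obtain s t where x: "x = s *s u + t *s v" by blast
  show "x \<in> vec.span {u, v}"
    unfolding x by (intro vec.span_add vec.span_scale vec.span_base) auto
qed

lemma dim_span2:
  assumes ind: "\<And>s t. s *s u + t *s v = 0 \<Longrightarrow> s = 0 \<and> t = 0"
  shows "vec.dim (vec.span {u, v :: 'k::field ^ 'n}) = 2"
proof -
  have "v \<noteq> 0" using ind[of 0 1] by auto
  have "u \<notin> vec.span {v}"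
  proof
    assume "u \<in> vec.span {v}"
    then obtain k where "u = k *s v" by (auto simp: vec.span_singleton)
    then have "1 *s u + (- k) *s v = 0" by (simp add: vector_smult_lneg)
    from ind[OF this] show False by simp
  qed
  then have "u \<noteq> v" using vec.span_base[of v "{v}"] by auto
  have "vec.independent {u, v}"
    using \<open>u \<notin> vec.span {v}\<close> \<open>v \<noteq> 0\<close> by (simp add: vec.independent_insert)
  then have "vec.dim {u, v} = card {u, v}" by (rule vec.dim_eq_card_independent)
  then show ?thesis using \<open>u \<noteq> v\<close> by simp
qed

section \<open>The arrangement\<close>

text \<open>The affine cone over the projective line that joins \<open>(a : b : c : 0)\<close> to the vertex
  \<open>(0 : 0 : 0 : 1)\<close>.\<close>

definition cone :: "'k \<Rightarrow> 'k \<Rightarrow> 'k \<Rightarrow> ('k::field ^ 4) set" where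
  "cone a b c = vec.span {vec4 a b c 0, vec4 0 0 0 1}"

definition transversal :: "('k::field ^ 4) set" where
  "transversal = vec.span {vec4 0 1 0 0, vec4 0 0 1 0}"

definition fermat_cones :: "('k::field ^ 4) set set" where
  "fermat_cones = {cone 1 0 0, cone 0 1 0, cone 0 0 1} \<union>
     {cone e d 1 | e d. e ^ 3 = 1 \<and> d ^ 3 = 1}"

definition planes :: "('k::field ^ 4) set set" where
  "planes = insert transversal fermat_cones"

lemma cone_eq: "cone a b c = {vec4 (s * a) (s * b) (s * c) t | s t. True}"
  unfolding cone_def span2
  by (rule Collect_cong) (auto simp: vec4_eq_iff)

lemma transversal_eq: "transversal = {vec4 0 s t 0 | s t. True}"
  unfolding transversal_def span2
  by (rule Collect_cong) (auto simp: vec4_eq_iff)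

lemma finite_planes: "finite (planes :: ('k::field ^ 4) set set)"
proof -
  have "finite {e::'k. poly (monom 1 3 - 1) e = 0}"
  proof (rule poly_roots_finite)
    have "coeff (monom 1 3 - 1 :: 'k poly) 3 = 1" by simp
    then show "monom 1 3 - 1 \<noteq> (0 :: 'k poly)" by (metis coeff_0 zero_neq_one)
  qed
  then have fin: "finite {e::'k. e ^ 3 = 1}" by (simp add: poly_monom)
  have "{cone e d 1 | e d :: 'k. e ^ 3 = 1 \<and> d ^ 3 = 1} =
      (\<lambda>(e, d). cone e d 1) ` ({e. e ^ 3 = 1} \<times> {d. d ^ 3 = 1})" by auto
  then show ?thesis using fin by (simp add: planes_def fermat_cones_def)
qed

lemma planes_subspace_dim:
  assumes "W \<in> planes" shows "vec.subspace W" "vec.dim W = 2"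
proof -
  have cone: "vec.dim (cone a b c) = 2" if "a \<noteq> 0 \<or> b \<noteq> 0 \<or> c \<noteq> 0" for a b c :: 'a
    unfolding cone_def by (rule dim_span2) (use that in \<open>auto simp: vec4_eq_iff\<close>)
  have "vec.dim transversal = 2"
    unfolding transversal_def by (rule dim_span2) (auto simp: vec4_eq_iff)
  with cone show "vec.dim W = 2"
    using assms by (auto simp: planes_def fermat_cones_def)
  show "vec.subspace W"
    using assms by (auto simp: planes_def fermat_cones_def cone_def transversal_def vec.subspace_span)
qed

text \<open>The subspaces \<open>{x = w = 0}\<close> and \<open>{y = z = 0}\<close> meet only in the origin.\<close>

lemma planes_not_concurrent:
  "\<not> (\<exists>p\<in>proj_points. \<forall>L\<in>proj_line ` planes. (p :: ('k::field ^ 4) set) \<in> L)"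
proof
  assume "\<exists>p\<in>proj_points. \<forall>L\<in>proj_line ` planes. (p :: ('k ^ 4) set) \<in> L"
  then obtain p :: "('k ^ 4) set" where
    p: "p \<in> proj_points" "p \<subseteq> transversal" "p \<subseteq> cone 1 0 0"
    by (auto simp: proj_line_def planes_def fermat_cones_def)
  have "p \<subseteq> {0}" using p(2,3) by (force simp: cone_eq transversal_eq vec4_eq_iff)
  then have "p \<subseteq> vec.span {}" by simp
  then have "vec.dim p \<le> card ({} :: ('k ^ 4) set)" by (intro vec.dim_le_card) auto
  with p(1) show False by (simp add: proj_points_def)
qed

definition planes_ideal :: "'k::field poly4 set" where
  "planes_ideal = (\<Inter>W\<in>planes. subspace_ideal W)"

lemma mem_subspace_ideal_cone:
  "f \<in> subspace_ideal (cone a b c) \<longleftrightarrow>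
    (\<forall>s t. poly4_eval f (vec4 (s * a) (s * b) (s * c) t) = 0)"
  by (auto simp: subspace_ideal_def cone_eq)

lemma mem_subspace_ideal_transversal:
  "f \<in> subspace_ideal transversal \<longleftrightarrow> (\<forall>s t. poly4_eval f (vec4 0 s t 0) = 0)"
  by (auto simp: subspace_ideal_def transversal_eq)

lemma mem_planes_ideal:
  "f \<in> planes_ideal \<longleftrightarrow> f \<in> subspace_ideal transversal \<and> f \<in> subspace_ideal (cone 1 0 0) \<and>
     f \<in> subspace_ideal (cone 0 1 0) \<and> f \<in> subspace_ideal (cone 0 0 1) \<and>
     (\<forall>e d. e ^ 3 = 1 \<longrightarrow> d ^ 3 = 1 \<longrightarrow> f \<in> subspace_ideal (cone e d 1))"
  by (auto simp: planes_ideal_def planes_def fermat_cones_def)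

section \<open>Extracting coefficients from vanishing sums\<close>

lemma coeff_sum_eq_0:
  fixes c :: "'a \<Rightarrow> 'k::field_char_0"
  assumes "\<And>s. s \<noteq> 0 \<Longrightarrow> (\<Sum>m\<in>S. c m * s ^ p m) = 0" and "finite S"
  shows "(\<Sum>m | m \<in> S \<and> p m = d. c m) = 0"
proof -
  let ?p = "\<Sum>m\<in>S. monom (c m) (p m)"
  have "?p = 0"
    by (rule poly_0_if_zero_off_0) (use assms in \<open>simp add: poly_sum poly_monom\<close>)
  then have "coeff ?p d = 0" by simp
  then show ?thesis using \<open>finite S\<close> by (simp add: coeff_sum sum.inter_filter)
qed

lemma primitive_cube_root_cubed:
  fixes w :: "'k::comm_ring_1"
  assumes "w\<^sup>2 + w + 1 = 0"
  shows "w ^ 3 = 1"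
proof -
  have "w ^ 3 - 1 = (w - 1) * (w\<^sup>2 + w + 1)"
    by (simp add: power3_eq_cube power2_eq_square algebra_simps)
  with assms show ?thesis by simp
qed

lemma sum_powers_cube_root:
  fixes w :: "'k::field_char_0"
  assumes w: "w\<^sup>2 + w + 1 = 0"
  shows "(\<Sum>k<3. (w ^ k) ^ n) = (if 3 dvd n then 3 else 0)"
proof -
  have w3: "w ^ 3 = 1" using w by (rule primitive_cube_root_cubed)
  have n: "w ^ n = w ^ (n mod 3)"
  proof -
    have "w ^ n = w ^ (3 * (n div 3) + n mod 3)" by simp
    also have "\<dots> = w ^ (n mod 3)" unfolding power_add power_mult w3 by simp
    finally show ?thesis .
  qed
  have "(\<Sum>k<3. (w ^ k) ^ n) = 1 + w ^ n + (w\<^sup>2) ^ n"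
    by (simp add: numeral_3_eq_3 numeral_2_eq_2)
  also have "\<dots> = 1 + w ^ n + (w ^ n)\<^sup>2"
    by (simp add: power_mult[symmetric] mult.commute)
  also have "\<dots> = 1 + w ^ (n mod 3) + (w ^ (n mod 3))\<^sup>2"
    using n by argo
  also have "\<dots> = (if 3 dvd n then 3 else 0)"
  proof -
    consider "n mod 3 = 0" | "n mod 3 = 1" | "n mod 3 = 2" by linarith
    then show ?thesis
    proof cases
      case 3
      have "(w\<^sup>2)\<^sup>2 = w" using w3 by (simp add: power2_eq_square power3_eq_cube mult.assoc)
      then show ?thesis using 3 w by (auto simp: dvd_eq_mod_eq_0 add_ac)
    qed (use w in \<open>auto simp: dvd_eq_mod_eq_0 add_ac\<close>)
  qed
  finally show ?thesis .
qed

text \<open>Fourier inversion over the group of cube roots of unity: the sum over these roots \<open>e\<close> of \<open>e\<close> to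
  the power \<open>p m - i\<close> is 3 or 0, according to whether \<open>p m\<close> and \<open>i\<close> are congruent modulo 3.\<close>

lemma residue_class_sum_eq_0:
  fixes c :: "'a \<Rightarrow> 'k::{alg_closed_field, field_char_0}"
  assumes zero: "\<And>e. e ^ 3 = 1 \<Longrightarrow> (\<Sum>m\<in>S. c m * e ^ p m) = 0" and "finite S"
  shows "(\<Sum>m | m \<in> S \<and> p m mod 3 = i mod 3. c m) = 0"
proof -
  have "\<exists>w::'k. poly [:1, 1, 1:] w = 0" by (rule alg_closed_imp_poly_has_root) simp
  then obtain w :: 'k where w: "w\<^sup>2 + w + 1 = 0"
    by (auto simp: power2_eq_square algebra_simps)
  then have w3: "w ^ 3 = 1" by (rule primitive_cube_root_cubed)
  have wk3: "(w ^ k) ^ 3 = 1" for k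
    by (metis w3 power_mult mult.commute power_one)
  have dvd: "3 dvd p m + 2 * i \<longleftrightarrow> p m mod 3 = i mod 3" for m
  proof -
    have "(3 * q + r + 2 * (3 * q' + r')) mod 3 = (r + 2 * r') mod 3" for q r q' r' :: nat
    proof -
      have "3 * q + r + 2 * (3 * q' + r') = 3 * (q + 2 * q') + (r + 2 * r')" by simp
      then show ?thesis by (simp only: mod_mult_self4)
    qed
    from this[of "p m div 3" "p m mod 3" "i div 3" "i mod 3"]
    have eq: "(p m + 2 * i) mod 3 = (p m mod 3 + 2 * (i mod 3)) mod 3"
      by (simp only: mult_div_mod_eq)
    have "(r + 2 * r') mod 3 = 0 \<longleftrightarrow> r = r'" if "r < 3" "r' < 3" for r r' :: nat
      using that by presburger
    then show ?thesis unfolding dvd_eq_mod_eq_0 eq by simp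
  qed
  have "0 = (\<Sum>k<3. (w ^ k) ^ (2 * i) * (\<Sum>m\<in>S. c m * (w ^ k) ^ p m))"
    using zero wk3 by simp
  also have "\<dots> = (\<Sum>m\<in>S. c m * (\<Sum>k<3. (w ^ k) ^ (p m + 2 * i)))"
    by (subst (2) sum_distrib_left, subst sum_distrib_left, subst sum.swap)
       (simp add: power_add mult_ac)
  also have "\<dots> = 3 * (\<Sum>m | m \<in> S \<and> p m mod 3 = i mod 3. c m)"
    unfolding sum_powers_cube_root[OF w] dvd
    using \<open>finite S\<close> by (simp add: sum_distrib_left sum.inter_filter mult.commute if_distrib cong: if_cong)
  finally show ?thesis by simp
qed

section \<open>Coefficients of the polynomials that vanish on the arrangement\<close>

text \<open>A cone is stable under scaling \<open>(x, y, z)\<close> and \<open>w\<close> independently, so the bihomogeneous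
  components of a polynomial that vanishes on it vanish on it as well.\<close>

lemma bigraded_part_vanishes:
  fixes f :: "'k::field_char_0 poly4"
  assumes "f \<in> subspace_ideal (cone a b c)"
  shows "(\<Sum>m | m \<in> keys f \<and> lookup m 1 + lookup m 2 + lookup m 3 = d \<and> lookup m 4 = l.
    lookup f m * a ^ lookup m 1 * b ^ lookup m 2 * c ^ lookup m 3) = 0"
proof -
  let ?c = "\<lambda>m. lookup f m * a ^ lookup m 1 * b ^ lookup m 2 * c ^ lookup m 3"
  let ?deg = "\<lambda>m :: 4 \<Rightarrow>\<^sub>0 nat. lookup m 1 + lookup m 2 + lookup m 3"
  have expand: "poly4_eval f (vec4 (s * a) (s * b) (s * c) t) =
      (\<Sum>m\<in>keys f. ?c m * t ^ lookup m 4 * s ^ ?deg m)" for s t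
  proof -
    have "monomial_value (vec4 (s * a) (s * b) (s * c) t) m =
        a ^ lookup m 1 * b ^ lookup m 2 * c ^ lookup m 3 * t ^ lookup m 4 * s ^ ?deg m" for m
      by (subst mon_lookup[symmetric], subst monomial_value_mon)
        (simp add: power_mult_distrib power_add mult_ac)
    then show ?thesis
      by (subst poly4_eval_alt[of "keys f"]) (simp_all add: mult.assoc)
  qed
  have "(\<Sum>m | m \<in> {m \<in> keys f. ?deg m = d} \<and> lookup m 4 = l. ?c m) = 0"
  proof (rule coeff_sum_eq_0)
    fix t :: 'k
    show "(\<Sum>m\<in>{m \<in> keys f. ?deg m = d}. ?c m * t ^ lookup m 4) = 0"
      by (rule coeff_sum_eq_0) (use assms expand[symmetric] in \<open>simp_all add: mem_subspace_ideal_cone\<close>)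
  qed simp
  then show ?thesis by (simp add: conj_assoc)
qed

lemma pure_power_coeffs_eq_0:
  fixes f :: "'k::field_char_0 poly4"
  shows "f \<in> subspace_ideal (cone 1 0 0) \<Longrightarrow> lookup f (mon n 0 0 l) = 0"
    and "f \<in> subspace_ideal (cone 0 1 0) \<Longrightarrow> lookup f (mon 0 n 0 l) = 0"
    and "f \<in> subspace_ideal (cone 0 0 1) \<Longrightarrow> lookup f (mon 0 0 n l) = 0"
proof -
  have *: "lookup f M = 0"
    if f: "f \<in> subspace_ideal (cone a b c)"
      and M: "lookup M 1 + lookup M 2 + lookup M 3 = n" "lookup M 4 = l"
      and val: "\<And>m. lookup m 1 + lookup m 2 + lookup m 3 = n \<Longrightarrow> lookup m 4 = l \<Longrightarrow>
        a ^ lookup m 1 * b ^ lookup m 2 * c ^ lookup m 3 = (if m = M then 1 else 0)"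
    for a b c M
  proof -
    let ?S = "{m \<in> keys f. lookup m 1 + lookup m 2 + lookup m 3 = n \<and> lookup m 4 = l}"
    have "0 = (\<Sum>m\<in>?S. lookup f m * (a ^ lookup m 1 * b ^ lookup m 2 * c ^ lookup m 3))"
      using bigraded_part_vanishes[OF f, of n l] by (simp add: mult.assoc)
    also have "\<dots> = (\<Sum>m\<in>?S. if m = M then lookup f m else 0)"
      by (rule sum.cong[OF refl]) (simp add: val)
    also have "\<dots> = lookup f M" using M by (simp add: sum.delta in_keys_iff)
    finally show ?thesis by simp
  qed
  show "lookup f (mon n 0 0 l) = 0" if "f \<in> subspace_ideal (cone 1 0 0)"
  proof (rule *[OF that])
    fix m :: "4 \<Rightarrow>\<^sub>0 nat"
    assume m: "lookup m 1 + lookup m 2 + lookup m 3 = n" "lookup m 4 = l"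
    obtain i j k h where "m = mon i j k h" by (rule mon_cases)
    with m show "1 ^ lookup m 1 * 0 ^ lookup m 2 * 0 ^ lookup m 3 = (if m = mon n 0 0 l then 1 else (0 :: 'k))"
      by (auto simp: power_0_left)
  qed simp_all
  show "lookup f (mon 0 n 0 l) = 0" if "f \<in> subspace_ideal (cone 0 1 0)"
  proof (rule *[OF that])
    fix m :: "4 \<Rightarrow>\<^sub>0 nat"
    assume m: "lookup m 1 + lookup m 2 + lookup m 3 = n" "lookup m 4 = l"
    obtain i j k h where "m = mon i j k h" by (rule mon_cases)
    with m show "0 ^ lookup m 1 * 1 ^ lookup m 2 * 0 ^ lookup m 3 = (if m = mon 0 n 0 l then 1 else (0 :: 'k))"
      by (auto simp: power_0_left)
  qed simp_all
  show "lookup f (mon 0 0 n l) = 0" if "f \<in> subspace_ideal (cone 0 0 1)"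
  proof (rule *[OF that])
    fix m :: "4 \<Rightarrow>\<^sub>0 nat"
    assume m: "lookup m 1 + lookup m 2 + lookup m 3 = n" "lookup m 4 = l"
    obtain i j k h where "m = mon i j k h" by (rule mon_cases)
    with m show "0 ^ lookup m 1 * 0 ^ lookup m 2 * 1 ^ lookup m 3 = (if m = mon 0 0 n l then 1 else (0 :: 'k))"
      by (auto simp: power_0_left)
  qed simp_all
qed

lemma residue_class_coeffs:
  fixes f :: "'k::{alg_closed_field, field_char_0} poly4"
  assumes f: "\<And>e d. e ^ 3 = 1 \<Longrightarrow> d ^ 3 = 1 \<Longrightarrow> f \<in> subspace_ideal (cone e d 1)"
    and T: "finite T" "\<And>m. m \<in> T \<longleftrightarrow> lookup m 1 + lookup m 2 + lookup m 3 = n \<and> lookup m 4 = l \<and>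
      lookup m 1 mod 3 = i mod 3 \<and> lookup m 2 mod 3 = j mod 3"
  shows "(\<Sum>m\<in>T. lookup f m) = 0"
proof -
  let ?S = "{m. m \<in> keys f \<and> lookup m 1 + lookup m 2 + lookup m 3 = n \<and> lookup m 4 = l}"
  have "(\<Sum>m | m \<in> {m. m \<in> ?S \<and> lookup m 1 mod 3 = i mod 3} \<and> lookup m 2 mod 3 = j mod 3.
      lookup f m) = 0"
  proof (rule residue_class_sum_eq_0)
    fix d :: 'k assume d: "d ^ 3 = 1"
    have "(\<Sum>m | m \<in> ?S \<and> lookup m 1 mod 3 = i mod 3. lookup f m * d ^ lookup m 2) = 0"
    proof (rule residue_class_sum_eq_0)
      fix e :: 'k assume e: "e ^ 3 = 1"
      have "(\<Sum>m\<in>?S. lookup f m * d ^ lookup m 2 * e ^ lookup m 1) =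
          (\<Sum>m\<in>?S. lookup f m * e ^ lookup m 1 * d ^ lookup m 2 * 1 ^ lookup m 3)"
        by (simp add: mult_ac)
      also have "\<dots> = 0" by (rule bigraded_part_vanishes[OF f[OF e d]])
      finally show "(\<Sum>m\<in>?S. lookup f m * d ^ lookup m 2 * e ^ lookup m 1) = 0" .
    qed simp
    then show "(\<Sum>m\<in>{m. m \<in> ?S \<and> lookup m 1 mod 3 = i mod 3}. lookup f m * d ^ lookup m 2) = 0" .
  qed simp
  also have "{m. m \<in> {m. m \<in> ?S \<and> lookup m 1 mod 3 = i mod 3} \<and> lookup m 2 mod 3 = j mod 3} =
      T \<inter> keys f"
    using T(2) by blast
  also have "(\<Sum>m\<in>T \<inter> keys f. lookup f m) = (\<Sum>m\<in>T. lookup f m)"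
    by (rule sum.mono_neutral_left) (use T(1) in \<open>auto simp: in_keys_iff\<close>)
  finally show ?thesis .
qed

text \<open>Exponents less than 3 are the least ones in their residue classes, so such a monomial is the only
  one in its class and degree.\<close>

lemma small_exponents_coeff_eq_0:
  fixes f :: "'k::{alg_closed_field, field_char_0} poly4"
  assumes f: "f \<in> planes_ideal" and "i < 3" "j < 3" "k < 3"
  shows "lookup f (mon i j k l) = 0"
proof -
  have "m \<in> {mon i j k l} \<longleftrightarrow> lookup m 1 + lookup m 2 + lookup m 3 = i + j + k \<and> lookup m 4 = l \<and>
      lookup m 1 mod 3 = i mod 3 \<and> lookup m 2 mod 3 = j mod 3" for m
  proof -
    obtain a b c e where m: "m = mon a b c e" by (rule mon_cases)
    have "a = i \<and> b = j \<and> c = k"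
      if "a + b + c = i + j + k" "a mod 3 = i mod 3" "b mod 3 = j mod 3"
    proof -
      have "i \<le> a" "j \<le> b"
        using that(2,3) assms(2,3) mod_less_eq_dividend[of a 3] mod_less_eq_dividend[of b 3] by simp_all
      moreover have "a < i + 3" "b < j + 3"
        using that(1) \<open>i \<le> a\<close> \<open>j \<le> b\<close> assms(4) by linarith+
      moreover have "3 * (a div 3) + i = a" "3 * (b div 3) + j = b"
        using that(2,3) assms(2,3) mult_div_mod_eq[of 3 a] mult_div_mod_eq[of 3 b] by simp_all
      ultimately have "a div 3 = 0" "b div 3 = 0" by linarith+
      then have "a = i" "b = j"
        using \<open>3 * (a div 3) + i = a\<close> \<open>3 * (b div 3) + j = b\<close> by simp_all
      then show ?thesis using that(1) by simp
    qed
    then show ?thesis by (auto simp: m)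
  qed
  from residue_class_coeffs[of f, OF _ _ this] f show ?thesis by (simp add: mem_planes_ideal)
qed

text \<open>The residue class of \<open>x\<^sup>3z\<^sup>k\<close> in degree \<open>k + 3\<close> consists of \<open>x\<^sup>3z\<^sup>k\<close>, \<open>y\<^sup>3z\<^sup>k\<close> and \<open>z\<^sup>k\<^sup>+\<^sup>3\<close>, and the last
  coefficient is 0 because of vanishing at \<open>(0 : 0 : 1)\<close>.\<close>

lemma coeff_swap:
  fixes f :: "'k::{alg_closed_field, field_char_0} poly4"
  assumes f: "f \<in> planes_ideal" and "k < 3"
  shows "lookup f (mon 3 0 k l) = - lookup f (mon 0 3 k l)"
proof -
  have "m \<in> {mon 3 0 k l, mon 0 3 k l, mon 0 0 (k + 3) l} \<longleftrightarrow>
      lookup m 1 + lookup m 2 + lookup m 3 = k + 3 \<and> lookup m 4 = l \<and>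
      lookup m 1 mod 3 = 0 mod 3 \<and> lookup m 2 mod 3 = 0 mod 3" for m
  proof -
    obtain a b c e where m: "m = mon a b c e" by (rule mon_cases)
    have "a = 3 \<and> b = 0 \<and> c = k \<or> a = 0 \<and> b = 3 \<and> c = k \<or> a = 0 \<and> b = 0 \<and> c = k + 3"
      if abc: "a + b + c = k + 3" "a mod 3 = 0" "b mod 3 = 0"
    proof -
      obtain a' b' where ab: "a = 3 * a'" "b = 3 * b'"
        using abc(2,3) by (auto simp: mod_eq_0_iff_dvd elim!: dvdE)
      then have "a' + b' \<le> 1" using abc(1) assms(2) by linarith
      then have "a' = 1 \<and> b' = 0 \<or> a' = 0 \<and> b' = 1 \<or> a' = 0 \<and> b' = 0" by linarith
      then show ?thesis using abc(1) ab by (elim disjE) simp_all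
    qed
    then show ?thesis by (auto simp: m)
  qed
  from residue_class_coeffs[of f, OF _ _ this] f
  have "lookup f (mon 3 0 k l) + lookup f (mon 0 3 k l) + lookup f (mon 0 0 (k + 3) l) = 0"
    by (simp add: mem_planes_ideal add_ac)
  then show ?thesis
    using f pure_power_coeffs_eq_0(3)[of f "k + 3" l] by (simp add: mem_planes_ideal eq_neg_iff_add_eq_0)
qed

lemma lookup_mult_mon:
  "lookup (f * g :: 'k::comm_ring_1 poly4) (mon a b c d) =
    (\<Sum>i\<le>a. \<Sum>j\<le>b. \<Sum>k\<le>c. \<Sum>l\<le>d.
      lookup f (mon i j k l) * lookup g (mon (a - i) (b - j) (c - k) (d - l)))"
proof -
  let ?K = "mon a b c d"
  let ?box = "{..a} \<times> {..b} \<times> {..c} \<times> {..d}"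
  let ?mon = "\<lambda>(i, j, k, l). mon i j k l"
  define B where "B = ?mon ` ?box"
  have "finite B" by (simp add: B_def)
  have box: "m \<in> B" if "m + n = ?K" for m n
  proof -
    have "lookup m i \<le> lookup ?K i" for i by (simp add: that[symmetric] lookup_add)
    from this[of 1] this[of 2] this[of 3] this[of 4]
    have "(lookup m 1, lookup m 2, lookup m 3, lookup m 4) \<in> ?box" by simp
    then show ?thesis using mon_lookup[of m] unfolding B_def by (force intro: rev_image_eqI)
  qed
  have "lookup (f * g) ?K = (\<Sum>m\<in>keys f. \<Sum>n\<in>keys g.
      if m + n = ?K then lookup f m * lookup g n else 0)"
    by (subst mult_eq_sum_singles) (simp add: lookup_sum lookup_single when_def)
  also have "\<dots> = (\<Sum>m\<in>keys f. if m \<in> B then lookup f m * lookup g (?K - m) else 0)"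
  proof (rule sum.cong[OF refl])
    fix m
    show "(\<Sum>n\<in>keys g. if m + n = ?K then lookup f m * lookup g n else 0) =
        (if m \<in> B then lookup f m * lookup g (?K - m) else 0)"
    proof (cases "m \<in> B")
      case True
      then obtain i j k l where m: "m = mon i j k l" "i \<le> a" "j \<le> b" "k \<le> c" "l \<le> d" unfolding B_def by auto
      then have K: "?K = m + mon (a - i) (b - j) (c - k) (d - l)" by simp
      then have "m + n = ?K \<longleftrightarrow> n = ?K - m" for n by (metis add_diff_cancel_left')
      then show ?thesis using True by (simp add: sum.delta in_keys_iff)
    next
      case False
      then have "m + n \<noteq> ?K" for n using box by blast
      with False show ?thesis by simp
    qed
  qed
  also have "\<dots> = (\<Sum>m\<in>B. lookup f m * lookup g (?K - m))"
    using \<open>finite B\<close> by (simp add: sum.If_cases, intro sum.mono_neutral_left) (auto simp: in_keys_iff)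
  also have "\<dots> = (\<Sum>x\<in>?box. lookup f (?mon x) * lookup g (?K - ?mon x))"
    unfolding B_def by (subst sum.reindex) (auto simp: inj_on_def)
  also have "\<dots> = (\<Sum>(i, j, k, l)\<in>?box.
      lookup f (mon i j k l) * lookup g (mon (a - i) (b - j) (c - k) (d - l)))"
  proof (rule sum.cong[OF refl], clarsimp)
    fix i j k l assume *: "i \<le> a" "j \<le> b" "k \<le> c" "l \<le> d"
    have "?K = mon i j k l + mon (a - i) (b - j) (c - k) (d - l)" using * by simp
    then have "?K - mon i j k l = mon (a - i) (b - j) (c - k) (d - l)"
      by (metis add_diff_cancel_left')
    then show "lookup f (mon i j k l) * lookup g (?K - mon i j k l) =
        lookup f (mon i j k l) * lookup g (mon (a - i) (b - j) (c - k) (d - l))" by simp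
  qed
  finally show ?thesis by (simp add: sum.cartesian_product)
qed

text \<open>The two convolutions agree term by term.  Terms with \<open>k = 0\<close> or \<open>k = 3\<close> contain a pure power, terms
  with \<open>i < 3\<close> or \<open>6 - i < 3\<close> contain a monomial with small exponents, and for \<open>i = 3\<close> both factors
  change sign.\<close>

lemma product_coeffs_swap:
  fixes f g :: "'k::{alg_closed_field, field_char_0} poly4"
  assumes f: "f \<in> planes_ideal" and g: "g \<in> planes_ideal"
  shows "lookup (f * g) (mon 6 0 3 n) = lookup (f * g) (mon 0 6 3 n)"
proof -
  have vertex: "lookup h (mon i 0 0 l) = 0" "lookup h (mon 0 i 0 l) = 0" "lookup h (mon 0 0 i l) = 0"
    if "h \<in> planes_ideal" for h :: "'k poly4" and i l
    using that pure_power_coeffs_eq_0 by (auto simp: mem_planes_ideal)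
  have "lookup f (mon i 0 k l) * lookup g (mon (6 - i) 0 (3 - k) (n - l)) =
      lookup f (mon 0 i k l) * lookup g (mon 0 (6 - i) (3 - k) (n - l))"
    if ik: "i \<le> 6" "k \<le> 3" for i k l
  proof -
    have "k = 0 \<or> k = 3 \<or> k < 3 \<and> 3 - k < 3 \<and> (i < 3 \<or> i = 3 \<or> 6 - i < 3)"
      using ik by linarith
    then consider "k = 0" | "k = 3" | "k < 3" "3 - k < 3" "i < 3" | "k < 3" "3 - k < 3" "i = 3"
      | "k < 3" "3 - k < 3" "6 - i < 3"
      by blast
    then show ?thesis
      by cases (simp_all add: f g vertex small_exponents_coeff_eq_0 coeff_swap)
  qed
  then show ?thesis by (simp add: lookup_mult_mon)
qed

section \<open>The Fermat form\<close>

definition vx :: "'k::field poly4" where "vx = single (mon 1 0 0 0) 1"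
definition vy :: "'k::field poly4" where "vy = single (mon 0 1 0 0) 1"
definition vz :: "'k::field poly4" where "vz = single (mon 0 0 1 0) 1"
definition vw :: "'k::field poly4" where "vw = single (mon 0 0 0 1) 1"
definition const :: "'k::field \<Rightarrow> 'k poly4" where "const c = single 0 c"

lemma eval_vars [simp]:
  "poly4_eval vx v = v $ 1" "poly4_eval vy v = v $ 2" "poly4_eval vz v = v $ 3"
  "poly4_eval vw v = v $ 4" "poly4_eval (const c) v = c"
  by (simp_all add: vx_def vy_def vz_def vw_def const_def monomial_value_mon)

lemma const_power: "const c ^ n = const (c ^ n)"
  by (induction n) (simp_all add: const_def mult_single)

definition fermat_form :: "'k::field poly4" where
  "fermat_form = (vx ^ 3 - vy ^ 3) * (vy ^ 3 - vz ^ 3) * (vz ^ 3 - vx ^ 3)"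

definition witness :: "'k::field poly4" where
  "witness = vw ^ 3 * fermat_form"

lemma witness_coeffs:
  "lookup (witness :: 'k::field poly4) (mon 6 0 3 3) = 1"
  "lookup (witness :: 'k::field poly4) (mon 0 6 3 3) = - 1"
proof -
  have cubes: "vx ^ 3 = single (mon 3 0 0 0) (1::'k)" "vy ^ 3 = single (mon 0 3 0 0) (1::'k)"
    "vz ^ 3 = single (mon 0 0 3 0) (1::'k)" "vw ^ 3 = single (mon 0 0 0 3) (1::'k)"
    by (simp_all add: vx_def vy_def vz_def vw_def power3_eq_cube mult_single) (simp_all add: numeral_3_eq_3)
  have eq: "witness = single (mon 6 0 3 3) 1 - single (mon 0 6 3 3) 1
      + single (mon 3 6 0 3) 1 - single (mon 6 3 0 3) 1
      + single (mon 0 3 6 3) 1 - single (mon 3 0 6 3) (1::'k)"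
    unfolding witness_def fermat_form_def cubes
    by (simp add: left_diff_distrib right_diff_distrib distrib_left distrib_right mult_single)
  show "lookup (witness :: 'k poly4) (mon 6 0 3 3) = 1"
    "lookup (witness :: 'k poly4) (mon 0 6 3 3) = - 1"
    unfolding eq by (simp_all add: lookup_add lookup_minus lookup_single when_def)
qed

lemma witness_notin_square:
  "(witness :: 'k::{alg_closed_field, field_char_0} poly4) \<notin> ideal_power planes_ideal 2"
proof
  assume "(witness :: 'k poly4) \<in> ideal_power planes_ideal 2"
  then have "lookup (witness :: 'k poly4) (mon 6 0 3 3) = lookup witness (mon 0 6 3 3)"
  proof (rule ideal_square_induct[rotated])
    show "is_ideal (planes_ideal :: 'k poly4 set)"
      unfolding planes_ideal_def by (rule is_ideal_Inter_subspace_ideal)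
  qed (simp_all add: product_coeffs_swap lookup_add)
  then show False by (simp add: witness_coeffs)
qed

lemma cleared_product_in_cube:
  assumes "s * a \<in> I" "s * b \<in> I" "s * c \<in> I" "F = u * (a * b * c)"
  shows "s ^ 3 * F \<in> ideal_power I 3"
proof -
  have "s ^ 3 * F = u * ((s * a) * (s * b) * (s * c))"
    by (simp add: assms(4) power3_eq_cube mult_ac)
  then show ?thesis using assms by (simp only: cube_in_ideal_power)
qed

lemma power_notin_subspace_ideal:
  "s \<notin> subspace_ideal W \<Longrightarrow> s ^ n \<notin> subspace_ideal W"
  by (auto simp: subspace_ideal_def)

text \<open>A power of a polynomial that vanishes on all the lines except the given one serves as \<open>s\<close>.  The
  cubic factor of the witness comes from \<open>w\<^sup>3\<close> for the line \<open>{x = w = 0}\<close>, from \<open>y\<^sup>3 - z\<^sup>3\<close> and its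
  permutations for the coordinate points, and from the three lines of the Fermat arrangement through
  the point for the points \<open>(e : d : 1)\<close>.\<close>

lemma witness_locally_in_cube:
  fixes W :: "('k::{alg_closed_field, field_char_0} ^ 4) set"
  assumes W: "W \<in> planes"
  shows "\<exists>s. s \<notin> subspace_ideal W \<and> s * witness \<in> ideal_power planes_ideal 3"
proof -
  have cubes: "(\<exists>s. s \<notin> subspace_ideal W \<and> s * witness \<in> ideal_power planes_ideal 3)"
    if "s \<notin> subspace_ideal W" "s * a \<in> planes_ideal" "s * b \<in> planes_ideal"
      "witness = u * a ^ 3 - v * b ^ 3" for s a b u v
  proof (intro exI conjI)
    show "s ^ 3 \<notin> subspace_ideal W" using that by (intro power_notin_subspace_ideal)
    have "s ^ 3 * (u * (a * a * a)) - s ^ 3 * (v * (b * b * b)) \<in> ideal_power planes_ideal 3"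
    proof (rule diff_in_ideal_power)
      show "s ^ 3 * (u * (a * a * a)) \<in> ideal_power planes_ideal 3"
        using that by (intro cleared_product_in_cube[OF _ _ _ refl])
      show "s ^ 3 * (v * (b * b * b)) \<in> ideal_power planes_ideal 3"
        using that by (intro cleared_product_in_cube[OF _ _ _ refl])
    qed
    then show "s ^ 3 * witness \<in> ideal_power planes_ideal 3"
      by (simp add: that power3_eq_cube algebra_simps)
  qed
  note planes_mem = mem_planes_ideal mem_subspace_ideal_cone mem_subspace_ideal_transversal
  consider "W = transversal" | "W = cone 1 0 0" | "W = cone 0 1 0" | "W = cone 0 0 1"
    | e d where "W = cone e d 1" "e ^ 3 = 1" "d ^ 3 = 1"
    using W by (auto simp: planes_def fermat_cones_def)
  then show ?thesis
  proof cases
    case 1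
    show ?thesis
    proof (rule cubes)
      show "vy * (vz ^ 3 - vx ^ 3) \<notin> subspace_ideal W"
        by (auto simp: 1 mem_subspace_ideal_transversal intro!: exI[of _ 1])
      show "vy * (vz ^ 3 - vx ^ 3) * vw \<in> planes_ideal"
        by (auto simp: planes_mem power_mult_distrib)
      show "vy * (vz ^ 3 - vx ^ 3) * 0 \<in> planes_ideal" by (auto simp: planes_mem)
      show "witness = fermat_form * vw ^ 3 - 0 * 0 ^ 3" by (simp add: witness_def mult.commute)
    qed
  next
    case 2
    show ?thesis
    proof (rule cubes)
      let ?s = "vw * vx * (vx ^ 3 - vy ^ 3) :: 'k poly4"
      show "?s \<notin> subspace_ideal W"
        by (auto simp: 2 mem_subspace_ideal_cone intro!: exI[of _ 1])
      show "?s * vy \<in> planes_ideal" "?s * vz \<in> planes_ideal"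
        by (auto simp: planes_mem power_mult_distrib)
      let ?u = "vw ^ 3 * (vx ^ 3 - vy ^ 3) * (vz ^ 3 - vx ^ 3) :: 'k poly4"
      show "witness = ?u * vy ^ 3 - ?u * vz ^ 3"
        unfolding witness_def fermat_form_def by (simp only: algebra_simps)
    qed
  next
    case 3
    show ?thesis
    proof (rule cubes)
      let ?s = "vw * vy * (vy ^ 3 - vz ^ 3) :: 'k poly4"
      show "?s \<notin> subspace_ideal W"
        by (auto simp: 3 mem_subspace_ideal_cone intro!: exI[of _ 1])
      show "?s * vz \<in> planes_ideal" "?s * vx \<in> planes_ideal"
        by (auto simp: planes_mem power_mult_distrib)
      let ?u = "vw ^ 3 * (vx ^ 3 - vy ^ 3) * (vy ^ 3 - vz ^ 3) :: 'k poly4"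
      show "witness = ?u * vz ^ 3 - ?u * vx ^ 3"
        unfolding witness_def fermat_form_def by (simp only: algebra_simps)
    qed
  next
    case 4
    show ?thesis
    proof (rule cubes)
      let ?s = "vw * vz * (vz ^ 3 - vx ^ 3) :: 'k poly4"
      show "?s \<notin> subspace_ideal W"
        by (auto simp: 4 mem_subspace_ideal_cone intro!: exI[of _ 1])
      show "?s * vx \<in> planes_ideal" "?s * vy \<in> planes_ideal"
        by (auto simp: planes_mem power_mult_distrib)
      let ?u = "vw ^ 3 * (vy ^ 3 - vz ^ 3) * (vz ^ 3 - vx ^ 3) :: 'k poly4"
      show "witness = ?u * vx ^ 3 - ?u * vy ^ 3"
        unfolding witness_def fermat_form_def by (simp only: algebra_simps)
    qed
  next
    case (5 e d)
    have nz: "e \<noteq> 0" "d \<noteq> 0" using 5 by auto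
    define E where "E = const e"
    define D where "D = const d"
    have ED: "E ^ 3 = 1" "D ^ 3 = 1"
      using 5 by (simp_all add: E_def D_def const_power) (simp_all add: const_def)
    have factor: "a ^ 3 - b ^ 3 = (a - b) * (a\<^sup>2 + a * b + b\<^sup>2)" for a b :: "'k poly4"
      by (simp add: power3_eq_cube power2_eq_square algebra_simps)
    \<comment> \<open>The quadratic factors vanish if the ratio \<open>x / z\<close> or \<open>y / z\<close> is one of the other two cube roots
      of unity; \<open>x y\<close> vanishes at the coordinate points and \<open>w\<close> on the remaining line.\<close>
    let ?s = "vw * vx * vy * (vx\<^sup>2 + vx * (E * vz) + (E * vz)\<^sup>2) * (vy\<^sup>2 + vy * (D * vz) + (D * vz)\<^sup>2)"
    \<comment> \<open>The three lines of the arrangement through \<open>(e : d : 1)\<close>.\<close>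
    let ?a = "vx - E * vz" and ?b = "vy - D * vz" and ?c = "D * vx - E * vy"
    have xz: "vx ^ 3 - vz ^ 3 = ?a * (vx\<^sup>2 + vx * (E * vz) + (E * vz)\<^sup>2)"
      using factor[of vx "E * vz"] by (simp add: power_mult_distrib ED)
    have yz: "vy ^ 3 - vz ^ 3 = ?b * (vy\<^sup>2 + vy * (D * vz) + (D * vz)\<^sup>2)"
      using factor[of vy "D * vz"] by (simp add: power_mult_distrib ED)
    have xy: "vx ^ 3 - vy ^ 3 = ?c * ((D * vx)\<^sup>2 + (D * vx) * (E * vy) + (E * vy)\<^sup>2)"
      using factor[of "D * vx" "E * vy"] by (simp add: power_mult_distrib ED)
    have root: "t = r \<or> t\<^sup>2 + t * r + r\<^sup>2 = 0" if "t ^ 3 = 1" "r ^ 3 = 1" for t r :: 'k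
    proof -
      have "(t - r) * (t\<^sup>2 + t * r + r\<^sup>2) = t ^ 3 - r ^ 3"
        by (simp add: power3_eq_cube power2_eq_square algebra_simps)
      then show ?thesis using that by auto
    qed
    have s: "poly4_eval ?s (vec4 (u * a) (u * b) (u * c) t) =
        t * u ^ 6 * a * b * (a\<^sup>2 + a * (e * c) + (e * c)\<^sup>2) * (b\<^sup>2 + b * (d * c) + (d * c)\<^sup>2)"
      for u a b c t
      by (simp add: E_def D_def power2_eq_square numeral_eq_Suc algebra_simps)
    have lin: "?s * l \<in> planes_ideal" if l: "l \<in> subspace_ideal (cone e d 1)" for l
      unfolding mem_planes_ideal
    proof (intro conjI allI impI)
      fix e' d' :: 'k assume *: "e' ^ 3 = 1" "d' ^ 3 = 1"
      show "?s * l \<in> subspace_ideal (cone e' d' 1)"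
      proof (cases "e' = e \<and> d' = d")
        case True
        with l show ?thesis by (simp add: mem_subspace_ideal_cone)
      next
        case False
        then have "e'\<^sup>2 + e' * e + e\<^sup>2 = 0 \<or> d'\<^sup>2 + d' * d + d\<^sup>2 = 0"
          using root * 5 by blast
        then show ?thesis
          unfolding mem_subspace_ideal_cone poly4_eval_mult[of ?s] s by auto
      qed
    qed (unfold mem_subspace_ideal_cone poly4_eval_mult[of ?s] s, simp_all add: mem_subspace_ideal_transversal)
    show ?thesis
    proof (intro exI conjI)
      have eval: "poly4_eval ?s (vec4 (1 * e) (1 * d) (1 * 1) 1) = e * d * (3 * e\<^sup>2) * (3 * d\<^sup>2)"
        unfolding s by (simp add: power2_eq_square)
      have "poly4_eval ?s (vec4 (1 * e) (1 * d) (1 * 1) 1) \<noteq> 0"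
        unfolding eval using nz by simp
      then have "?s \<notin> subspace_ideal W" unfolding 5(1) mem_subspace_ideal_cone by blast
      then show "?s ^ 3 \<notin> subspace_ideal W" by (rule power_notin_subspace_ideal)
      show "?s ^ 3 * witness \<in> ideal_power planes_ideal 3"
      proof (rule cleared_product_in_cube)
        show "?s * ?a \<in> planes_ideal" "?s * ?b \<in> planes_ideal" "?s * ?c \<in> planes_ideal"
          by (intro lin; simp add: mem_subspace_ideal_cone E_def D_def mult_ac)+
        have "witness = vw ^ 3 * (vx ^ 3 - vy ^ 3) * (vy ^ 3 - vz ^ 3) * (- (vx ^ 3 - vz ^ 3))"
          by (simp add: witness_def fermat_form_def mult.assoc)
        also have "\<dots> = - (vw ^ 3 * (vx\<^sup>2 + vx * (E * vz) + (E * vz)\<^sup>2)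
            * (vy\<^sup>2 + vy * (D * vz) + (D * vz)\<^sup>2)
            * ((D * vx)\<^sup>2 + (D * vx) * (E * vy) + (E * vy)\<^sup>2)) * (?a * ?b * ?c)"
          unfolding xz yz xy by (simp add: mult_ac)
        finally show "witness = - (vw ^ 3 * (vx\<^sup>2 + vx * (E * vz) + (E * vz)\<^sup>2)
            * (vy\<^sup>2 + vy * (D * vz) + (D * vz)\<^sup>2)
            * ((D * vx)\<^sup>2 + (D * vx) * (E * vy) + (E * vy)\<^sup>2)) * (?a * ?b * ?c)" .
      qed
    qed
  qed
qed

lemma witness_in_symbolic_cube:
  "(witness :: 'k::{alg_closed_field, field_char_0} poly4) \<in> symbolic_power planes_ideal 3"
proof (rule symbolic_powerI)
  fix P :: "'k poly4 set" assume "P \<in> associated_primes planes_ideal"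
  then obtain W where W: "W \<in> planes" "P \<subseteq> subspace_ideal W"
    using associated_prime_subset planes_subspace_dim(1) unfolding planes_ideal_def by metis
  then show "\<exists>s. s \<notin> P \<and> s * witness \<in> ideal_power planes_ideal 3"
    using witness_locally_in_cube by blast
qed

theorem mainTheorem1:
  shows "\<exists>\<L> :: 'k::{alg_closed_field, field_char_0} proj_point set set.
           finite \<L> \<and> \<L> \<subseteq> proj_lines \<and>
           \<not> (\<exists>p\<in>proj_points. \<forall>L\<in>\<L>. p \<in> L) \<and>
           \<not> symbolic_power (vanishing_ideal (\<Union>\<L>)) 3
               \<subseteq> ideal_power (vanishing_ideal (\<Union>\<L>)) 2"
proof -
  let ?\<L> = "proj_line ` planes :: 'k proj_point set set"
  have ideal: "vanishing_ideal (\<Union>?\<L>) = planes_ideal"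
    unfolding vanishing_ideal_Union planes_ideal_def image_image
    by (intro INF_cong refl vanishing_ideal_proj_line planes_subspace_dim)
  have "?\<L> \<subseteq> proj_lines"
    using planes_subspace_dim by (auto simp: proj_lines_def proj_line_def)
  then show ?thesis
    using finite_planes planes_not_concurrent[where 'k = 'k]
      witness_in_symbolic_cube[where 'k = 'k] witness_notin_square[where 'k = 'k]
    by (intro exI[of _ ?\<L>]) (auto simp only: ideal finite_imageI)
qed

end
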